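(* For every $r>0$ there exist constants $c_{1,r}>0$ and $c_{2,r}>0$ such that for all integers $N\ge 1$, the event $\mathrm{Hole}_{N,r}=\{\alpha=(\alpha_0,\dots,\alpha_N)\in\mathbb{C}^{N+1} : \psi_{\alpha,N}(z)\ne 0 \text{ for all } z\in B(0,r)\}$ satisfies $$e^{-c_{2,r}N^2}\le \mathrm{Prob}(\mathrm{Hole}_{N,r})\le e^{-c_{1,r}N^2}.$$
   Context: For an integer $N\ge 1$, the Gaussian random SU(2) polynomial of degree $N$ is $\psi_{\alpha,N}(z)=\sum_{j=0}^N \alpha_j\sqrt{\binom{N}{j}}\,z^j$, $z\in\mathbb{C}$, where $\alpha=(\alpha_0,\dots,\alpha_N)$ and the $\alpha_j$ are independent identically distributed standard complex Gaussian random variables (mean $0$, variance $1$, i.e. density $\frac1\pi e^{-|w|^2}$ on $\mathbb{C}$, so that $\mathrm{Prob}(|\alpha_j|\ge\lambda)=e^{-\lambda^2}$ for $\lambda\ge 0$). $B(0,r)$ is the disk in $\mathbb{C}$ of radius $r$ centered at $0$ (the event that a zero lies on its boundary is null). *)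

theory Defs
  imports "HOL-Probability.Probability"
begin

text \<open>\<^const>\<open>lborel\<close> on \<^typ>\<open>complex\<close> is area measure, normalised by the basis
  \<open>{1, \<i>}\<close>; hence \<open>E |w|\<^sup>2 = 1\<close> below, each of \<open>Re w\<close>, \<open>Im w\<close> having variance \<open>1/2\<close>.\<close>

definition complex_std_gaussian :: "complex measure" where
  "complex_std_gaussian = density lborel (\<lambda>w. ennreal (exp (- (cmod w)\<^sup>2) / pi))"

text \<open>Coefficient vectors \<open>(\<alpha>\<^sub>0, \<dots>, \<alpha>\<^sub>N)\<close> are extensional functions on \<open>{..N}\<close>; the product
  measure is their joint law for independent identically distributed coefficients.\<close>

definition coeff_measure :: "nat \<Rightarrow> (nat \<Rightarrow> complex) measure" where
  "coeff_measure N = (\<Pi>\<^sub>M j\<in>{..N}. complex_std_gaussian)"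

definition SU2_poly :: "(nat \<Rightarrow> complex) \<Rightarrow> nat \<Rightarrow> complex \<Rightarrow> complex" where
  "SU2_poly \<alpha> N z = (\<Sum>j\<le>N. \<alpha> j * complex_of_real (sqrt (real (N choose j))) * z ^ j)"

definition Hole :: "nat \<Rightarrow> real \<Rightarrow> (nat \<Rightarrow> complex) set" where
  "Hole N r = {\<alpha> \<in> {..N} \<rightarrow>\<^sub>E UNIV. \<forall>z\<in>ball 0 r. SU2_poly \<alpha> N z \<noteq> 0}"

end

theory Submission
  imports Defs "HOL-Complex_Analysis.Complex_Analysis" "HOL-Real_Asymp.Real_Asymp"
begin

unbundle no vec_syntax

text \<open>Upper bound: a polynomial \<open>F = \<Sum>\<^sub>k a\<^sub>k z\<^sup>k\<close> without zeros in the disk is \<open>exp G\<close> there. If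
  \<open>\<bar>F\<bar> < K\<close>, the Borel--Caratheodory and Cauchy inequalities give
  \<open>\<bar>G\<^sub>k\<bar> \<le> 2 ln (K / \<bar>a\<^sub>0\<bar>) (2 / r)\<^sup>k\<close>. The recursion for the coefficients of \<open>exp G\<close> is
  triangular, with \<open>a\<^sub>k - a\<^sub>0 G\<^sub>k\<close> a function of \<open>a\<^sub>0, \<dots>, a\<^sub>k\<^sub>-\<^sub>1\<close>, so each \<open>a\<^sub>k\<close> is confined, given its
  predecessors, to a disk of radius \<open>2 \<bar>a\<^sub>0\<bar> ln (K / \<bar>a\<^sub>0\<bar>) (2 / r)\<^sup>k\<close>. Off an event of probability
  \<open>O(N exp (- N\<^sup>2 / 2))\<close> all \<open>\<bar>\<alpha>\<^sub>j\<bar> \<le> N\<close>, and then this radius is \<open>O(N\<^sup>2 (2 / r)\<^sup>k)\<close>. The variance of \<open>a\<^sub>k\<close> is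
  \<open>N choose k \<ge> (N / k)\<^sup>k\<close>, so for \<open>k \<le> \<kappa> N\<close> with small \<open>\<kappa>\<close> the conditional probability of the disk
  is at most \<open>O(N\<^sup>4) exp (- 2 k)\<close>; multiplying over \<open>k \<le> \<kappa> N\<close> gives \<open>exp (- c N\<^sup>2)\<close>.
  Lower bound: the constant term dominates all others when \<open>\<bar>\<alpha>\<^sub>0\<bar> > 1 / 2\<close> and
  \<open>\<bar>\<alpha>\<^sub>j\<bar> \<le> (1 + r)\<^sup>-\<^sup>N / 2\<close> for \<open>j \<ge> 1\<close>.\<close>

subsection \<open>Coefficients of zero-free functions\<close>

text \<open>The Moebius map \<open>w / (2 * A - w)\<close> fixes 0 and sends the half plane
  \<open>Re w < A\<close> into the unit disk, so the Schwarz lemma applies to its composition with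
  the rescaled \<open>g\<close>. At half the radius this gives
  \<open>|g z| \<le> |2 * A - g z| / 2\<close>, and the triangle inequality absorbs half of
  \<open>|g z|\<close> on the left.\<close>

lemma Borel_Caratheodory_half:
  fixes g :: "complex \<Rightarrow> complex"
  assumes "0 < r" and holo: "g holomorphic_on ball 0 r" and "g 0 = 0"
    and Re_less: "\<And>z. z \<in> ball 0 r \<Longrightarrow> Re (g z) < A"
    and z: "cmod z \<le> r / 2"
  shows "cmod (g z) \<le> 2 * A"
proof -
  have "A > 0"
    using Re_less[of 0] assms by simp
  \<comment> \<open>The points 0 and \<open>2 * A\<close> are mirror images in the line
    \<open>Re w = A\<close>, and \<open>g w\<close> lies on the side of 0.\<close>
  have less: "cmod (g w) < cmod (2 * of_real A - g w)" if "w \<in> ball 0 r" for w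
  proof -
    have "(cmod (2 * of_real A - g w))\<^sup>2 - (cmod (g w))\<^sup>2 = 4 * A * (A - Re (g w))"
      unfolding cmod_power2 by (simp add: power2_eq_square algebra_simps)
    also have "\<dots> > 0"
      using Re_less[OF that] \<open>A > 0\<close> by simp
    finally show ?thesis
      by (simp add: power2_less_imp_less)
  qed
  define q where "q = (\<lambda>w. g (of_real r * w) / (2 * of_real A - g (of_real r * w)))"
  have scaled: "of_real r * w \<in> ball 0 r" if "cmod w < 1" for w :: complex
    using that \<open>0 < r\<close> by (simp add: norm_mult)
  have "(\<lambda>w. g (of_real r * w)) holomorphic_on ball 0 1"
    using scaled by (intro holomorphic_on_compose_gen[OF _ holo, unfolded o_def] holomorphic_intros) auto
  moreover have "2 * of_real A - g (of_real r * w) \<noteq> 0" if "w \<in> ball 0 1" for w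
    using less[OF scaled, of w] that by force
  ultimately have "q holomorphic_on ball 0 1"
    unfolding q_def by (intro holomorphic_intros)
  moreover have "q 0 = 0"
    by (simp add: q_def \<open>g 0 = 0\<close>)
  moreover have "cmod (q w) < 1" if "cmod w < 1" for w
    using less[OF scaled[OF that]] by (auto simp: q_def norm_divide divide_less_eq_1)
  ultimately have Schwarz: "cmod (q w) \<le> cmod w" if "cmod w < 1" for w
    using Schwarz_Lemma(1) that by blast
  have "cmod (z / of_real r) \<le> 1 / 2"
    using z \<open>0 < r\<close> by (simp add: norm_divide field_simps)
  then have "cmod (q (z / of_real r)) \<le> 1 / 2"
    using Schwarz[of "z / of_real r"] by linarith
  moreover have "z \<in> ball 0 r"
    using z \<open>0 < r\<close> by simp
  then have "0 < cmod (2 * of_real A - g z)"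
    using less[of z] norm_ge_zero[of "g z"] by linarith
  ultimately have "cmod (g z) \<le> cmod (2 * of_real A - g z) / 2"
    using \<open>0 < r\<close> by (simp add: q_def norm_divide field_simps)
  also have "\<dots> \<le> (2 * A + cmod (g z)) / 2"
    using norm_triangle_ineq4[of "2 * of_real A" "g z"] \<open>A > 0\<close> by (simp add: norm_mult)
  finally show ?thesis
    by simp
qed

text \<open>On the disk \<open>f\<close> has a holomorphic logarithm \<open>h\<close>. After
  subtraction of \<open>h 0\<close> its real part is \<open>ln (|f z| / |f 0|)\<close>, hence below
  \<open>ln (K / |F $ 0|)\<close>. Borel--Caratheodory bounds its modulus at radius
  \<open>r / 2\<close>, and Cauchy's inequality then bounds its Taylor coefficients; the factor
  \<open>Suc n\<close> comes from differentiation.\<close>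

lemma log_deriv_coeff_bound:
  fixes f :: "complex \<Rightarrow> complex"
  assumes "0 < r" and holo: "f holomorphic_on ball 0 r"
    and nz: "\<And>z. z \<in> ball 0 r \<Longrightarrow> f z \<noteq> 0"
    and less_K: "\<And>z. z \<in> ball 0 r \<Longrightarrow> cmod (f z) < K"
    and F: "f has_fps_expansion F"
  shows "cmod ((fps_deriv F * inverse F) $ n)
           \<le> real (Suc n) * (2 * ln (K / cmod (F $ 0))) * (2 / r) ^ Suc n"
proof -
  have F0: "F $ 0 = f 0"
    using F by (rule has_fps_expansion_imp_0_eq_fps_nth_0[symmetric])
  have "F $ 0 \<noteq> 0"
    using nz[of 0] \<open>0 < r\<close> F0 by simp
  obtain h where h: "h holomorphic_on ball 0 r" "\<And>z. z \<in> ball 0 r \<Longrightarrow> f z = exp (h z)"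
    using iffD1[OF simply_connected_eq_holomorphic_log convex_imp_simply_connected[OF convex_ball]]
      holo nz by (metis open_ball)
  define g where "g = (\<lambda>z. h z - h 0)"
  define A where "A = ln (K / cmod (F $ 0))"
  have g: "g holomorphic_on ball 0 r" "g 0 = 0"
    unfolding g_def by (auto intro!: holomorphic_intros h)
  have "Re (g z) < A" if z: "z \<in> ball 0 r" for z
  proof -
    have "exp (Re (g z)) = cmod (f z) / cmod (f 0)"
      using h(2)[OF z] h(2)[of 0] \<open>0 < r\<close> by (simp add: g_def exp_diff)
    also have "\<dots> < K / cmod (F $ 0)"
      using less_K[OF z] \<open>F $ 0 \<noteq> 0\<close> F0 by (simp add: divide_strict_right_mono)
    finally have "ln (exp (Re (g z))) < A"
      unfolding A_def by (subst ln_less_cancel_iff) (auto intro: less_trans[OF exp_gt_zero])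
    then show ?thesis by simp
  qed
  then have bound: "cmod (g z) \<le> 2 * A" if "cmod z \<le> r / 2" for z
    using Borel_Caratheodory_half[OF \<open>0 < r\<close> g] that by blast
  have sub: "cball 0 (r / 2) \<subseteq> (ball 0 r :: complex set)"
    using \<open>0 < r\<close> by auto
  have "cmod ((deriv ^^ Suc n) g 0) \<le> fact (Suc n) * (2 * A) / (r / 2) ^ Suc n"
  proof (rule Cauchy_inequality)
    show "g holomorphic_on ball 0 (r / 2)"
      using g(1) by (rule holomorphic_on_subset) (use \<open>0 < r\<close> in auto)
    show "continuous_on (cball 0 (r / 2)) g"
      using g(1) sub by (meson holomorphic_on_imp_continuous_on continuous_on_subset)
  qed (use \<open>0 < r\<close> bound in auto)
  then have coeff: "cmod (fps_expansion g 0 $ Suc n) \<le> 2 * A * (2 / r) ^ Suc n"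
    using \<open>0 < r\<close>
    by (simp add: fps_expansion_def norm_divide norm_mult field_simps power_divide
             del: fact_Suc funpow.simps power_Suc of_nat_Suc)
  have G: "g has_fps_expansion fps_expansion g 0"
    using g(1) \<open>0 < r\<close> by (intro has_fps_expansion_fps_expansion[of "ball 0 r"]) auto
  \<comment> \<open>The identity \<open>f' = g' * f\<close> near 0 passes to formal power series by
    uniqueness of expansions; after that the division by \<open>F\<close> is purely formal.\<close>
  have "deriv f has_fps_expansion fps_deriv (fps_expansion g 0) * F"
  proof -
    have "(\<lambda>z. deriv g z * f z) has_fps_expansion fps_deriv (fps_expansion g 0) * F"
      by (intro has_fps_expansion_mult has_fps_expansion_deriv G F)
    moreover have "deriv g z * f z = deriv f z" if z: "z \<in> ball 0 r" for z
    proof -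
      have dg: "(g has_field_derivative deriv g z) (at z)"
        using g(1) z by (intro holomorphic_derivI[of _ "ball 0 r"]) auto
      have "((\<lambda>z. exp (g z + h 0)) has_field_derivative exp (g z + h 0) * deriv g z) (at z)"
        by (auto intro!: derivative_eq_intros dg)
      then have "(f has_field_derivative exp (g z + h 0) * deriv g z) (at z)"
        by (rule has_field_derivative_transform_within_open[where S = "ball 0 r"]) (use z h in \<open>auto simp: g_def\<close>)
      then show ?thesis
        using h(2)[OF z] by (simp add: g_def DERIV_imp_deriv)
    qed
    then have "eventually (\<lambda>z. deriv g z * f z = deriv f z) (nhds 0)"
      using \<open>0 < r\<close> by (intro eventually_nhds_in_open[THEN eventually_mono, of "ball 0 r"]) auto
    ultimately show ?thesis
      by (subst (asm) has_fps_expansion_cong) auto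
  qed
  then have "fps_deriv F = fps_deriv (fps_expansion g 0) * F"
    using has_fps_expansion_deriv[OF F] fps_expansion_unique_complex by blast
  then have "fps_deriv F * inverse F = fps_deriv (fps_expansion g 0)"
    using \<open>F $ 0 \<noteq> 0\<close> by (simp add: mult.assoc inverse_mult_eq_1')
  then have "cmod ((fps_deriv F * inverse F) $ n) = real (Suc n) * cmod (fps_expansion g 0 $ Suc n)"
    by (simp add: norm_mult del: of_nat_Suc)
  also have "\<dots> \<le> real (Suc n) * (2 * A * (2 / r) ^ Suc n)"
    using coeff by (intro mult_left_mono) auto
  finally show ?thesis
    by (simp add: A_def mult.assoc)
qed

text \<open>If \<open>F = exp G\<close>, then \<open>exp_centre F n\<close> is the part of \<open>F\<^sub>n\<^sub>+\<^sub>1\<close> determined by \<open>F\<^sub>0, \<dots>, F\<^sub>n\<close>;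
  the remainder is \<open>F\<^sub>0 G\<^sub>n\<^sub>+\<^sub>1\<close>. It is read off from the logarithmic derivative \<open>F' / F = G'\<close>.\<close>

definition exp_centre :: "complex fps \<Rightarrow> nat \<Rightarrow> complex" where
  "exp_centre F n = - (F $ 0 / of_nat (Suc n)) *
     (\<Sum>k<n. of_nat (Suc k) * F $ Suc k * inverse F $ (n - k))"

text \<open>In the Cauchy product for \<open>F' / F\<close> only the last term contains
  \<open>F $ Suc n\<close>, with factor \<open>Suc n / F $ 0\<close>. Solving for that coefficient
  turns all other terms into the centre.\<close>

lemma exp_centre_eq:
  assumes "F $ 0 \<noteq> 0"
  shows "F $ Suc n - exp_centre F n
           = F $ 0 / of_nat (Suc n) * (fps_deriv F * inverse F) $ n"
proof -
  have "(fps_deriv F * inverse F) $ n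
      = (\<Sum>k<n. of_nat (Suc k) * F $ Suc k * inverse F $ (n - k)) + of_nat (Suc n) * F $ Suc n / F $ 0"
    by (simp add: fps_mult_nth atLeast0AtMost flip: lessThan_Suc_atMost)
       (simp add: divide_inverse)
  then show ?thesis
    using assms by (simp add: exp_centre_def field_simps del: of_nat_Suc)
qed

lemma fps_inverse_nth_cong:
  fixes F G :: "complex fps"
  assumes "\<And>j. j \<le> n \<Longrightarrow> F $ j = G $ j"
  shows "inverse F $ n = inverse G $ n"
  using assms
proof (induction n rule: less_induct)
  case (less n)
  then show ?case
  proof (cases n)
    case (Suc m)
    have "(\<Sum>i = 1..n. F $ i * inverse F $ (n - i)) = (\<Sum>i = 1..n. G $ i * inverse G $ (n - i))"
      using less.prems by (intro sum.cong refl arg_cong2[of _ _ _ _ "(*)"] less.IH) auto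
    with less.prems[of 0] show ?thesis
      by (simp add: Suc fps_inverse_def fps_right_inverse_constructor.simps)
  qed simp
qed

text \<open>Triangularity of the recursion. It allows the centre to be frozen while the next
  coefficient is integrated.\<close>

lemma exp_centre_cong:
  assumes "\<And>j. j \<le> n \<Longrightarrow> F $ j = G $ j"
  shows "exp_centre F n = exp_centre G n"
  unfolding exp_centre_def using assms
  by (intro arg_cong2[of _ _ _ _ "(*)"] sum.cong fps_inverse_nth_cong) auto

text \<open>The factor \<open>Suc n\<close> of the logarithmic derivative cancels. The dependence on
  the constant term has the form \<open>x * ln (K / x)\<close>, which stays bounded as
  \<open>x\<close> tends to 0; this later permits arbitrarily small
  \<open>\<alpha> 0\<close>.\<close>

lemma nonvanishing_coeff_bound:
  fixes f :: "complex \<Rightarrow> complex"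
  assumes "0 < r" "f holomorphic_on ball 0 r"
    and "\<And>z. z \<in> ball 0 r \<Longrightarrow> f z \<noteq> 0"
    and "\<And>z. z \<in> ball 0 r \<Longrightarrow> cmod (f z) < K"
    and F: "f has_fps_expansion F"
  shows "cmod (F $ Suc n - exp_centre F n)
           \<le> 2 * (cmod (F $ 0) * ln (K / cmod (F $ 0))) * (2 / r) ^ Suc n"
proof -
  have F0: "F $ 0 \<noteq> 0"
    using assms(3)[of 0] \<open>0 < r\<close> has_fps_expansion_imp_0_eq_fps_nth_0[OF F] by simp
  have "cmod (F $ Suc n - exp_centre F n)
      = cmod (F $ 0) / real (Suc n) * cmod ((fps_deriv F * inverse F) $ n)"
    using F0 by (simp only: exp_centre_eq norm_mult norm_divide norm_of_nat not_False_eq_True)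
  also have "\<dots> \<le> cmod (F $ 0) / real (Suc n) *
      (real (Suc n) * (2 * ln (K / cmod (F $ 0))) * (2 / r) ^ Suc n)"
    using log_deriv_coeff_bound[OF assms] by (intro mult_left_mono) auto
  finally show ?thesis
    by (simp add: mult.assoc mult.left_commute del: of_nat_Suc power_Suc)
qed

subsection \<open>Sequential bounds in product spaces\<close>

lemma sets_PiM_sequential:
  fixes M :: "nat \<Rightarrow> 'a measure"
  assumes S: "\<And>k. S k \<in> sets (Pi\<^sub>M {..k} M)"
  shows "{f \<in> space (Pi\<^sub>M {..<n} M). \<forall>k<n. restrict f {..k} \<in> S k} \<in> sets (Pi\<^sub>M {..<n} M)"
proof -
  have "{f \<in> space (Pi\<^sub>M {..<n} M). restrict f {..k} \<in> S k} \<in> sets (Pi\<^sub>M {..<n} M)" if "k < n" for k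
  proof -
    have "(\<lambda>f. restrict f {..k}) \<in> measurable (Pi\<^sub>M {..<n} M) (Pi\<^sub>M {..k} M)"
      using that by (intro measurable_restrict_subset) auto
    then have "(\<lambda>f. restrict f {..k}) -` S k \<inter> space (Pi\<^sub>M {..<n} M) \<in> sets (Pi\<^sub>M {..<n} M)"
      using S by (rule measurable_sets)
    also have "(\<lambda>f. restrict f {..k}) -` S k \<inter> space (Pi\<^sub>M {..<n} M)
        = {f \<in> space (Pi\<^sub>M {..<n} M). restrict f {..k} \<in> S k}"
      by blast
    finally show ?thesis .
  qed
  then have "{f \<in> space (Pi\<^sub>M {..<n} M). \<forall>k\<in>{..<n}. restrict f {..k} \<in> S k} \<in> sets (Pi\<^sub>M {..<n} M)"
    by (intro sets.sets_Collect_finite_All finite_lessThan) (simp only: lessThan_iff)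
  then show ?thesis
    by (simp only: Ball_def lessThan_iff)
qed

text \<open>Chain rule for conditional probabilities, by induction on \<open>n\<close>: Fubini
  integrates the last coordinate first, and its fibre has measure at most \<open>q n\<close>
  uniformly in the earlier coordinates.\<close>

lemma emeasure_PiM_sequential_le:
  fixes M :: "nat \<Rightarrow> 'a measure" and q :: "nat \<Rightarrow> ennreal"
  assumes prob: "\<And>k. prob_space (M k)"
    and S: "\<And>k. S k \<in> sets (Pi\<^sub>M {..k} M)"
    and section_le: "\<And>k f. f \<in> space (Pi\<^sub>M {..<k} M) \<Longrightarrow>
      emeasure (M k) {x \<in> space (M k). f(k := x) \<in> S k} \<le> q k"
  shows "emeasure (Pi\<^sub>M {..<n} M) {f \<in> space (Pi\<^sub>M {..<n} M). \<forall>k<n. restrict f {..k} \<in> S k}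
           \<le> (\<Prod>k<n. q k)"
proof -
  interpret product_sigma_finite M
    by (intro product_sigma_finite.intro prob_space_imp_sigma_finite prob)
  define E where "E n = {f \<in> space (Pi\<^sub>M {..<n} M). \<forall>k<n. restrict f {..k} \<in> S k}" for n
  have E: "E n \<in> sets (Pi\<^sub>M {..<n} M)" for n
    unfolding E_def by (rule sets_PiM_sequential[OF S])
  have "emeasure (Pi\<^sub>M {..<n} M) (E n) \<le> (\<Prod>k<n. q k)"
  proof (induction n)
    case 0
    interpret P: prob_space "Pi\<^sub>M {..<0::nat} M"
      by (intro prob_space_PiM prob)
    show ?case
      by (simp only: lessThan_0 prod.empty) (use P.emeasure_le_1 in simp)
  next
    case (Suc n)
    have ins: "{..<Suc n} = insert n {..<n}"
      by auto
    have E': "E (Suc n) \<in> sets (Pi\<^sub>M (insert n {..<n}) M)"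
      using E[of "Suc n"] by (simp only: ins)
    have "emeasure (Pi\<^sub>M {..<Suc n} M) (E (Suc n))
        = (\<integral>\<^sup>+ f. indicator (E (Suc n)) f \<partial>Pi\<^sub>M (insert n {..<n}) M)"
      using E' by (simp only: ins nn_integral_indicator)
    also have "\<dots> = (\<integral>\<^sup>+ f. \<integral>\<^sup>+ x. indicator (E (Suc n)) (f(n := x)) \<partial>M n \<partial>Pi\<^sub>M {..<n} M)"
      using E' by (intro product_nn_integral_insert) auto
    also have "\<dots> \<le> (\<integral>\<^sup>+ f. q n * indicator (E n) f \<partial>Pi\<^sub>M {..<n} M)"
    proof (intro nn_integral_mono)
      fix f assume f: "f \<in> space (Pi\<^sub>M {..<n} M)"
      \<comment> \<open>Conditions with \<open>k < n\<close> do not see the new coordinate and the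
        one with \<open>k = n\<close> sees the whole vector, so the indicator of
        \<open>E (Suc n)\<close> factors into that of \<open>E n\<close> and that of the fibre of
        \<open>S n\<close>.\<close>
      have ext: "restrict (f(n := x)) {..k} = (if k < n then restrict f {..k} else f(n := x))"
        if "k \<le> n" for x k
        using f that by (auto simp: fun_eq_iff space_PiM PiE_def extensional_def)
      have upd: "f(n := x) \<in> E (Suc n) \<longleftrightarrow> f \<in> E n \<and> f(n := x) \<in> S n" if "x \<in> space (M n)" for x
      proof -
        have "f(n := x) \<in> space (Pi\<^sub>M {..<Suc n} M)"
          using f that by (auto simp: space_PiM PiE_iff extensional_def less_Suc_eq)
        then show ?thesis
          using f by (auto simp: E_def ext less_Suc_eq le_simps)
      qed
      have "(\<integral>\<^sup>+ x. indicator (E (Suc n)) (f(n := x)) \<partial>M n)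
          = (\<integral>\<^sup>+ x. indicator (E n) f * indicator {x \<in> space (M n). f(n := x) \<in> S n} x \<partial>M n)"
        using upd by (intro nn_integral_cong) (auto simp: indicator_def)
      also have "\<dots> = indicator (E n) f * emeasure (M n) {x \<in> space (M n). f(n := x) \<in> S n}"
      proof (subst nn_integral_cmult_indicator)
        have "insert n {..<n} = {..n}"
          by auto
        then have "(\<lambda>x. f(n := x)) \<in> measurable (M n) (Pi\<^sub>M {..n} M)"
          using measurable_component_update[of f "{..<n}" M n] f by simp
        then have "(\<lambda>x. f(n := x)) -` S n \<inter> space (M n) \<in> sets (M n)"
          using S by (rule measurable_sets)
        also have "(\<lambda>x. f(n := x)) -` S n \<inter> space (M n) = {x \<in> space (M n). f(n := x) \<in> S n}"
          by blast
        finally show "{x \<in> space (M n). f(n := x) \<in> S n} \<in> sets (M n)" .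
      qed simp
      also have "\<dots> \<le> q n * indicator (E n) f"
        using section_le[OF f] by (auto simp: indicator_def)
      finally show "(\<integral>\<^sup>+ x. indicator (E (Suc n)) (f(n := x)) \<partial>M n) \<le> q n * indicator (E n) f" .
    qed
    also have "\<dots> = q n * emeasure (Pi\<^sub>M {..<n} M) (E n)"
      using E by (rule nn_integral_cmult_indicator)
    also have "\<dots> \<le> q n * (\<Prod>k<n. q k)"
      by (intro mult_left_mono Suc) auto
    finally show ?case
      by (simp add: mult.commute)
  qed
  then show ?thesis
    by (simp add: E_def)
qed

subsection \<open>The Gaussian coefficient measure\<close>

lemma nn_integral_gaussian_real:
  assumes "a > 0"
  shows "(\<integral>\<^sup>+ x. ennreal (exp (- (a * x\<^sup>2))) \<partial>lborel) = ennreal (sqrt (pi / a))"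
proof -
  define \<sigma> where "\<sigma> = sqrt (1 / (2 * a))"
  have \<sigma>: "\<sigma> > 0" "2 * \<sigma>\<^sup>2 = 1 / a"
    using assms by (simp_all add: \<sigma>_def)
  have eq: "exp (- (a * x\<^sup>2)) = sqrt (pi / a) * normal_density 0 \<sigma> x" for x
  proof -
    have "2 * pi * \<sigma>\<^sup>2 = pi / a" "- ((x - 0)\<^sup>2 / (2 * \<sigma>\<^sup>2)) = - (a * x\<^sup>2)"
      using \<sigma>(2) by (simp_all add: field_simps)
    then show ?thesis
      using assms by (simp add: normal_density_def)
  qed
  interpret prob_space "density lborel (normal_density 0 \<sigma>)"
    using \<sigma>(1) by (rule prob_space_normal_density)
  have "(\<integral>\<^sup>+ x. ennreal (normal_density 0 \<sigma> x) \<partial>lborel) = 1"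
    using emeasure_space_1 by (simp add: emeasure_density)
  moreover have "(\<integral>\<^sup>+ x. ennreal (exp (- (a * x\<^sup>2))) \<partial>lborel)
      = (\<integral>\<^sup>+ x. ennreal (sqrt (pi / a)) * ennreal (normal_density 0 \<sigma> x) \<partial>lborel)"
    unfolding eq using assms by (intro nn_integral_cong ennreal_mult) auto
  ultimately show ?thesis
    by (simp add: nn_integral_cmult)
qed

text \<open>The integrand factors over real and imaginary part. The scale is free because
  \<open>a = 1\<close> gives the normalisation and \<open>a = 1 / 2\<close> the tail
  estimate.\<close>

lemma nn_integral_gaussian_complex:
  assumes "a > 0"
  shows "(\<integral>\<^sup>+ w. ennreal (exp (- (a * (cmod w)\<^sup>2))) \<partial>lborel) = ennreal (pi / a)"
proof -
  have "ennreal (exp (- (a * (cmod w)\<^sup>2)))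
      = (\<Prod>b\<in>Basis. ennreal (exp (- (a * (w \<bullet> b)\<^sup>2))))" for w :: complex
    by (simp add: Basis_complex_def cmod_power2 distrib_left exp_add[symmetric] flip: ennreal_mult)
  then have "(\<integral>\<^sup>+ w. ennreal (exp (- (a * (cmod w)\<^sup>2))) \<partial>lborel)
      = (\<Prod>b\<in>(Basis :: complex set). \<integral>\<^sup>+ x. ennreal (exp (- (a * x\<^sup>2))) \<partial>lborel)"
    by (simp only:) (rule nn_integral_lborel_prod; simp)
  also have "\<dots> = ennreal (sqrt (pi / a)) * ennreal (sqrt (pi / a))"
    using assms by (simp add: nn_integral_gaussian_real Basis_complex_def)
  finally show ?thesis
    using assms by (simp flip: ennreal_mult)
qed

lemma sets_complex_std_gaussian [measurable_cong, simp]: "sets complex_std_gaussian = sets borel"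
  by (simp add: complex_std_gaussian_def)

lemma space_complex_std_gaussian [simp]: "space complex_std_gaussian = UNIV"
  by (simp add: complex_std_gaussian_def)

lemma emeasure_complex_std_gaussian:
  "A \<in> sets borel \<Longrightarrow> emeasure complex_std_gaussian A =
     (\<integral>\<^sup>+ w. ennreal (exp (- (cmod w)\<^sup>2) / pi) * indicator A w \<partial>lborel)"
  by (simp add: complex_std_gaussian_def emeasure_density)

interpretation gaussian: prob_space complex_std_gaussian
proof
  have "emeasure complex_std_gaussian UNIV
      = (\<integral>\<^sup>+ w. ennreal (1 / pi) * ennreal (exp (- (1 * (cmod w)\<^sup>2))) \<partial>lborel)"
    by (subst emeasure_complex_std_gaussian) (auto intro!: nn_integral_cong simp flip: ennreal_mult)
  also have "\<dots> = ennreal (1 / pi) * ennreal (pi / 1)"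
    by (subst nn_integral_cmult) (auto simp only: nn_integral_gaussian_complex zero_less_one, simp)
  finally show "emeasure complex_std_gaussian (space complex_std_gaussian) = 1"
    by (simp flip: ennreal_mult)
qed

lemma emeasure_lborel_cball_complex:
  "R \<ge> 0 \<Longrightarrow> emeasure lborel (cball (w :: complex) R) = ennreal (pi * R\<^sup>2)"
  by (simp add: emeasure_cball unit_ball_vol_2)

text \<open>The density never exceeds \<open>1 / pi\<close>, so the bound is uniform in
  \<open>w\<close>. This matters because the centre of a confining disk varies with the earlier
  coefficients.\<close>

lemma emeasure_gaussian_cball_le:
  assumes "R \<ge> 0"
  shows "emeasure complex_std_gaussian (cball w R) \<le> ennreal (R\<^sup>2)"
proof -
  have "emeasure complex_std_gaussian (cball w R)
      \<le> (\<integral>\<^sup>+ x. ennreal (1 / pi) * indicator (cball w R) x \<partial>lborel)"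
    by (subst emeasure_complex_std_gaussian)
       (auto intro!: nn_integral_mono mult_right_mono ennreal_leI divide_right_mono)
  also have "\<dots> = ennreal (1 / pi) * ennreal (pi * R\<^sup>2)"
    using assms by (simp add: nn_integral_cmult_indicator emeasure_lborel_cball_complex)
  finally show ?thesis
    by (simp flip: ennreal_mult)
qed

lemma prob_gaussian_cball_le: "R \<ge> 0 \<Longrightarrow> gaussian.prob (cball w R) \<le> R\<^sup>2"
  using emeasure_gaussian_cball_le[of R w] by (simp add: gaussian.emeasure_eq_measure)

lemma prob_gaussian_cball_ge:
  assumes "R \<ge> 0"
  shows "exp (- R\<^sup>2) * R\<^sup>2 \<le> gaussian.prob (cball 0 R)"
proof -
  have "ennreal (exp (- R\<^sup>2) / pi) * ennreal (pi * R\<^sup>2)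
      = (\<integral>\<^sup>+ x. ennreal (exp (- R\<^sup>2) / pi) * indicator (cball (0 :: complex) R) x \<partial>lborel)"
    using assms by (simp add: nn_integral_cmult_indicator emeasure_lborel_cball_complex)
  also have "\<dots> \<le> emeasure complex_std_gaussian (cball 0 R)"
    by (subst emeasure_complex_std_gaussian)
       (auto intro!: nn_integral_mono ennreal_leI divide_right_mono power_mono simp: indicator_def)
  finally show ?thesis
    by (simp add: gaussian.emeasure_eq_measure flip: ennreal_mult)
qed

text \<open>Half of the exponent is spent on the decay in \<open>t\<close>, the other half keeps the
  integral finite. The exact value is \<open>exp (- t^2)\<close>; the weaker bound follows without
  polar coordinates.\<close>

lemma prob_gaussian_tail_le:
  assumes "t \<ge> 0"
  shows "gaussian.prob {w. t < cmod w} \<le> 2 * exp (- t\<^sup>2 / 2)"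
proof -
  have "emeasure complex_std_gaussian {w. t < cmod w}
      \<le> (\<integral>\<^sup>+ w. ennreal (exp (- t\<^sup>2 / 2) / pi) * ennreal (exp (- (1 / 2 * (cmod w)\<^sup>2))) \<partial>lborel)"
  proof (subst emeasure_complex_std_gaussian, measurable, intro nn_integral_mono)
    fix w :: complex
    have "exp (- (cmod w)\<^sup>2) \<le> exp (- t\<^sup>2 / 2) * exp (- (1 / 2 * (cmod w)\<^sup>2))" if "t < cmod w"
    proof -
      have "t\<^sup>2 \<le> (cmod w)\<^sup>2"
        using that assms by (intro power_mono) auto
      then have "- (cmod w)\<^sup>2 \<le> - t\<^sup>2 / 2 + - (1 / 2 * (cmod w)\<^sup>2)"
        by simp
      then show ?thesis
        by (simp only: mult_exp_exp exp_le_cancel_iff)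
    qed
    then show "ennreal (exp (- (cmod w)\<^sup>2) / pi) * indicator {w. t < cmod w} w
        \<le> ennreal (exp (- t\<^sup>2 / 2) / pi) * ennreal (exp (- (1 / 2 * (cmod w)\<^sup>2)))"
      by (auto simp: indicator_def divide_right_mono simp flip: ennreal_mult intro!: ennreal_leI)
  qed
  also have "\<dots> = ennreal (exp (- t\<^sup>2 / 2) / pi) * ennreal (pi / (1 / 2))"
    by (subst nn_integral_cmult) (measurable, subst nn_integral_gaussian_complex, simp_all)
  also have "\<dots> = ennreal (2 * exp (- t\<^sup>2 / 2))"
    by (simp flip: ennreal_mult)
  finally show ?thesis
    by (simp add: gaussian.emeasure_eq_measure)
qed

section \<open>Joint law of the coefficients and measurability of the hole event\<close>

lemma sets_coeff_measure [measurable_cong, simp]: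
  "sets (coeff_measure N) = sets (Pi\<^sub>M {..N} (\<lambda>_. borel))"
  unfolding coeff_measure_def by (intro sets_PiM_cong) auto

lemma space_coeff_measure [simp]: "space (coeff_measure N) = {..N} \<rightarrow>\<^sub>E UNIV"
  by (simp add: coeff_measure_def space_PiM)

lemma prob_space_coeff_measure: "prob_space (coeff_measure N)"
  unfolding coeff_measure_def by (intro prob_space_PiM gaussian.prob_space_axioms)

lemma measure_coeff_measure_box:
  assumes "\<And>j. j \<le> N \<Longrightarrow> A j \<in> sets borel"
  shows "measure (coeff_measure N) (Pi\<^sub>E {..N} A) = (\<Prod>j\<le>N. gaussian.prob (A j))"
proof -
  interpret product_sigma_finite "\<lambda>_ :: nat. complex_std_gaussian"
    by (intro product_sigma_finite.intro gaussian.sigma_finite_measure)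
  interpret P: prob_space "coeff_measure N"
    by (rule prob_space_coeff_measure)
  have "emeasure (coeff_measure N) (Pi\<^sub>E {..N} A) = ennreal (\<Prod>j\<le>N. gaussian.prob (A j))"
    unfolding coeff_measure_def using assms
    by (subst emeasure_PiM) (simp_all add: gaussian.emeasure_eq_measure prod_ennreal)
  then show ?thesis
    by (simp add: P.emeasure_eq_measure prod_nonneg)
qed

lemma measure_coeff_measure_component:
  assumes "j \<le> N" "A \<in> sets borel"
  shows "measure (coeff_measure N) {\<alpha> \<in> space (coeff_measure N). \<alpha> j \<in> A} = gaussian.prob A"
proof -
  have "{\<alpha> \<in> space (coeff_measure N). \<alpha> j \<in> A} = Pi\<^sub>E {..N} (\<lambda>i. if i = j then A else UNIV)"
    using assms(1) by (auto simp: PiE_iff extensional_def) (metis atMost_iff)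
  moreover have "(\<Prod>i\<le>N. gaussian.prob (if i = j then A else UNIV)) = (\<Prod>i\<le>N. if i = j then gaussian.prob A else 1)"
    using gaussian.prob_space by (intro prod.cong) auto
  ultimately show ?thesis
    using assms by (simp add: measure_coeff_measure_box)
qed

lemma measurable_coeff_component [measurable]:
  "j \<le> N \<Longrightarrow> (\<lambda>\<alpha>. \<alpha> j) \<in> borel_measurable (coeff_measure N)"
  by measurable

lemma measurable_SU2_poly [measurable]:
  "(\<lambda>\<alpha>. SU2_poly \<alpha> N z) \<in> borel_measurable (coeff_measure N)"
  unfolding SU2_poly_def by (intro borel_measurable_sum borel_measurable_times) auto

lemma continuous_on_SU2_poly: "continuous_on S (SU2_poly \<alpha> N)"
  unfolding SU2_poly_def by (intro continuous_intros)

text \<open>By compactness a zero in the open disk can be detected on a countable dense set.\<close>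

lemma sets_Hole: "Hole N r \<in> sets (coeff_measure N)"
proof -
  obtain D :: "complex set" where D: "countable D" "\<And>X. open X \<Longrightarrow> X \<noteq> {} \<Longrightarrow> \<exists>d\<in>D. d \<in> X"
    using countable_dense_exists[where 'a = complex] by blast
  \<comment> \<open>The margin \<open>1 / Suc k\<close> keeps the approximating points in a compact
    subdisk, so the zero they detect cannot lie on the boundary circle.\<close>
  have zero_iff: "(\<exists>z\<in>ball 0 r. SU2_poly \<alpha> N z = 0) \<longleftrightarrow>
      (\<exists>k::nat. \<forall>n::nat. \<exists>d\<in>D. cmod d < r - 1 / Suc k \<and> cmod (SU2_poly \<alpha> N d) < 1 / Suc n)"
    (is "?L \<longleftrightarrow> ?R") for \<alpha>
  proof
    assume ?L
    then obtain z where z: "cmod z < r" "SU2_poly \<alpha> N z = 0"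
      by auto
    then obtain k where k: "1 / Suc k < r - cmod z"
      using nat_approx_posE[of "r - cmod z"] by auto
    have "\<exists>d\<in>D. cmod d < r - 1 / Suc k \<and> cmod (SU2_poly \<alpha> N d) < 1 / Suc n" for n
    proof -
      have "open ({d. cmod d < r - 1 / Suc k} \<inter> {d. cmod (SU2_poly \<alpha> N d) < 1 / Suc n})"
        by (intro open_Int open_Collect_less continuous_intros continuous_on_SU2_poly)
      moreover have "z \<in> {d. cmod d < r - 1 / Suc k} \<inter> {d. cmod (SU2_poly \<alpha> N d) < 1 / Suc n}"
        using z k by simp
      ultimately show ?thesis
        using D(2) by blast
    qed
    then show ?R by blast
  next
    assume ?R
    then obtain k :: nat where k:
      "\<And>n :: nat. \<exists>d\<in>D. cmod d < r - 1 / Suc k \<and> cmod (SU2_poly \<alpha> N d) < 1 / Suc n"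
      by blast
    define C :: "complex set" where "C = cball 0 (r - 1 / Suc k)"
    have "C \<noteq> {}"
      using k[of 0] by (auto simp: C_def dest: le_less_trans[OF norm_ge_zero])
    moreover have "compact C"
      by (simp add: C_def)
    moreover have "continuous_on C (\<lambda>z. cmod (SU2_poly \<alpha> N z))"
      by (intro continuous_on_norm continuous_on_SU2_poly)
    ultimately obtain z where
      z: "z \<in> C" "\<And>d. d \<in> C \<Longrightarrow> cmod (SU2_poly \<alpha> N z) \<le> cmod (SU2_poly \<alpha> N d)"
      using continuous_attains_inf by meson
    have "SU2_poly \<alpha> N z = 0"
    proof (rule ccontr)
      assume "SU2_poly \<alpha> N z \<noteq> 0"
      then obtain n where "1 / Suc n < cmod (SU2_poly \<alpha> N z)"
        using nat_approx_posE[of "cmod (SU2_poly \<alpha> N z)"] by auto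
      moreover obtain d where "cmod d < r - 1 / Suc k" "cmod (SU2_poly \<alpha> N d) < 1 / Suc n"
        using k by blast
      moreover from this have "d \<in> C"
        by (simp add: C_def)
      ultimately show False
        using z(2)[of d] by linarith
    qed
    moreover have "cmod z < r"
    proof -
      have "cmod z \<le> r - 1 / Suc k"
        using z(1) by (simp add: C_def)
      moreover have "0 < 1 / real (Suc k)"
        by simp
      ultimately show ?thesis
        by linarith
    qed
    ultimately show ?L by auto
  qed
  have "Hole N r = {\<alpha> \<in> space (coeff_measure N). \<not> (\<exists>k::nat. \<forall>n::nat. \<exists>d\<in>D.
      cmod d < r - 1 / Suc k \<and> cmod (SU2_poly \<alpha> N d) < 1 / Suc n)}"
    unfolding Hole_def zero_iff[symmetric] by auto
  also have "\<dots> \<in> sets (coeff_measure N)"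
    using D(1) by measurable
  finally show ?thesis .
qed

subsection \<open>Confinement of the coefficients on the hole event\<close>

text \<open>The binomial coefficient is 0 for \<open>j > N\<close>, which truncates the series at
  degree \<open>N\<close> whatever the values of \<open>\<alpha>\<close> there.\<close>

definition SU2_fps :: "(nat \<Rightarrow> complex) \<Rightarrow> nat \<Rightarrow> complex fps" where
  "SU2_fps \<alpha> N = Abs_fps (\<lambda>j. \<alpha> j * complex_of_real (sqrt (real (N choose j))))"

lemma SU2_fps_nth [simp]: "SU2_fps \<alpha> N $ j = \<alpha> j * complex_of_real (sqrt (real (N choose j)))"
  by (simp add: SU2_fps_def)

lemma SU2_poly_has_fps_expansion: "SU2_poly \<alpha> N has_fps_expansion SU2_fps \<alpha> N"
proof -
  have "SU2_fps \<alpha> N = (\<Sum>j\<le>N. fps_const (\<alpha> j * complex_of_real (sqrt (real (N choose j)))) * fps_X ^ j)"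
    by (rule fps_ext) (auto simp: fps_sum_nth if_distrib cong: if_cong)
  moreover have "(\<lambda>z. \<Sum>j\<le>N. \<alpha> j * complex_of_real (sqrt (real (N choose j))) * z ^ j) has_fps_expansion
      (\<Sum>j\<le>N. fps_const (\<alpha> j * complex_of_real (sqrt (real (N choose j)))) * fps_X ^ j)"
    by (intro fps_expansion_intros)
  ultimately show ?thesis
    by (simp add: SU2_poly_def[abs_def])
qed

text \<open>A positive integer dominates its square root, so the weights can be replaced by the
  binomial coefficients and the binomial theorem sums the series.\<close>

lemma norm_SU2_poly_le:
  assumes "\<And>j. j \<le> N \<Longrightarrow> cmod (\<alpha> j) \<le> B" and "cmod z \<le> r"
  shows "cmod (SU2_poly \<alpha> N z) \<le> B * (1 + r) ^ N"
proof -
  have "r \<ge> 0" "B \<ge> 0"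
    using assms(2) assms(1)[of 0] by (auto intro: order_trans[OF norm_ge_zero])
  have "cmod (SU2_poly \<alpha> N z) \<le> (\<Sum>j\<le>N. B * (real (N choose j) * r ^ j))"
    unfolding SU2_poly_def
  proof (rule sum_norm_le)
    fix j assume "j \<in> {..N}"
    then have "real (N choose j) \<ge> 1"
      by (simp add: Suc_leI)
    then have "sqrt (real (N choose j)) \<le> real (N choose j)"
      by (intro real_le_lsqrt self_le_power) auto
    then show "cmod (\<alpha> j * complex_of_real (sqrt (real (N choose j))) * z ^ j)
        \<le> B * (real (N choose j) * r ^ j)"
      using assms \<open>j \<in> {..N}\<close> \<open>r \<ge> 0\<close> \<open>B \<ge> 0\<close>
      by (auto simp: norm_mult norm_power mult.assoc intro!: mult_mono power_mono)
  qed
  also have "\<dots> = B * (1 + r) ^ N"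
    using binomial_ring[of r 1 N] by (simp add: sum_distrib_left add.commute)
  finally show ?thesis .
qed

lemma Hole_nonzero: "\<alpha> \<in> Hole N r \<Longrightarrow> 0 < r \<Longrightarrow> \<alpha> 0 \<noteq> 0"
proof -
  assume "\<alpha> \<in> Hole N r" "0 < r"
  then have "SU2_poly \<alpha> N 0 \<noteq> 0"
    by (auto simp: Hole_def)
  then show ?thesis
    by (auto simp: SU2_poly_def power_0_left if_distrib cong: if_cong)
qed

lemma Hole_coeff_bound:
  assumes "0 < r" and \<alpha>: "\<alpha> \<in> Hole N r"
    and B: "\<And>j. j \<le> N \<Longrightarrow> cmod (\<alpha> j) \<le> B" and K: "B * (1 + r) ^ N < K"
  shows "cmod (\<alpha> (Suc n) * complex_of_real (sqrt (real (N choose Suc n))) - exp_centre (SU2_fps \<alpha> N) n)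
           \<le> 2 * (cmod (\<alpha> 0) * ln (K / cmod (\<alpha> 0))) * (2 / r) ^ Suc n"
proof -
  have "SU2_poly \<alpha> N holomorphic_on ball 0 r"
    unfolding SU2_poly_def[abs_def] by (intro holomorphic_intros)
  moreover have "cmod (SU2_poly \<alpha> N z) < K" if "z \<in> ball 0 r" for z
    using norm_SU2_poly_le[of N \<alpha> B z r] B that K by auto
  ultimately show ?thesis
    using nonvanishing_coeff_bound[OF \<open>0 < r\<close> _ _ _ SU2_poly_has_fps_expansion, of \<alpha> N K n] \<alpha>
    by (simp add: Hole_def del: power_Suc)
qed

text \<open>Each coefficient of the reciprocal is a finite expression in earlier ones. Where the
  constant term is 0 the convention \<open>inverse 0 = 0\<close> applies, and the recursion still
  holds.\<close>

lemma measurable_fps_inverse_nth: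
  fixes F :: "'a \<Rightarrow> complex fps"
  assumes "\<And>j. j \<le> n \<Longrightarrow> (\<lambda>x. F x $ j) \<in> borel_measurable M"
  shows "(\<lambda>x. inverse (F x) $ n) \<in> borel_measurable M"
  using assms
proof (induction n rule: less_induct)
  case (less n)
  show ?case
  proof (cases n)
    case 0
    with less.prems[of 0] show ?thesis by simp
  next
    case (Suc m)
    have "(\<lambda>x. F x $ i * inverse (F x) $ (n - i)) \<in> borel_measurable M" if "i \<in> {1..n}" for i
      using that less.prems by (intro borel_measurable_times less.IH) auto
    then have "(\<lambda>x. \<Sum>i = 1..n. F x $ i * inverse (F x) $ (n - i)) \<in> borel_measurable M"
      by (rule borel_measurable_sum)
    then have "(\<lambda>x. - inverse (F x $ 0) * (\<Sum>i = 1..n. F x $ i * inverse (F x) $ (n - i))) \<in> borel_measurable M"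
      using less.prems[of 0] by (intro borel_measurable_times) auto
    then show ?thesis
      by (simp add: Suc fps_inverse_def)
  qed
qed

lemma measurable_exp_centre:
  assumes "\<And>j. j \<le> n \<Longrightarrow> (\<lambda>x. F x $ j) \<in> borel_measurable M"
  shows "(\<lambda>x. exp_centre (F x) n) \<in> borel_measurable M"
  unfolding exp_centre_def using assms
  by (intro borel_measurable_times borel_measurable_sum measurable_fps_inverse_nth
        borel_measurable_uminus borel_measurable_divide borel_measurable_const) auto

text \<open>Conditionally on \<open>\<alpha>\<^sub>0, \<dots>, \<alpha>\<^sub>k\<^sub>-\<^sub>1\<close> the coefficient \<open>\<alpha>\<^sub>k\<close> is confined to a disk of area
  \<open>\<pi> (\<rho> k)\<^sup>2 / (N choose k)\<close>.\<close>

lemma prob_exp_centre_le: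
  fixes \<rho> :: "nat \<Rightarrow> real"
  assumes "m \<le> N" and \<rho>: "\<And>k. \<rho> k \<ge> 0"
  shows "measure (coeff_measure N) {\<alpha> \<in> space (coeff_measure N). \<forall>k\<in>{1..m}.
      cmod (\<alpha> k * complex_of_real (sqrt (real (N choose k))) - exp_centre (SU2_fps \<alpha> N) (k - 1)) \<le> \<rho> k}
    \<le> (\<Prod>k=1..m. (\<rho> k)\<^sup>2 / real (N choose k))" (is "measure _ ?E \<le> _")
proof -
  define G where "G = (\<lambda>_ :: nat. complex_std_gaussian)"
  define T where "T k = {\<alpha> \<in> space (Pi\<^sub>M {..k} G).
      cmod (\<alpha> k * complex_of_real (sqrt (real (N choose k))) - exp_centre (SU2_fps \<alpha> N) (k - 1)) \<le> \<rho> k}" for k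
  \<comment> \<open>Outside \<open>{1..m}\<close> the condition is vacuous and its factor is 1, so
    the sequential bound can run over all \<open>N + 1\<close> coordinates.\<close>
  define S where "S k = (if k \<in> {1..m} then T k else space (Pi\<^sub>M {..k} G))" for k
  define q where "q k = (if k \<in> {1..m} then ennreal ((\<rho> k)\<^sup>2 / real (N choose k)) else 1)" for k
  have component: "(\<lambda>\<alpha>. \<alpha> j) \<in> borel_measurable (Pi\<^sub>M {..k} G)" if "j \<le> k" for j k
    using that measurable_component_singleton[of j "{..k}" G] by (simp add: G_def cong: measurable_cong_sets)
  have S: "S k \<in> sets (Pi\<^sub>M {..k} G)" for k
  proof -
    have [measurable]: "(\<lambda>\<alpha>. exp_centre (SU2_fps \<alpha> N) (k - 1)) \<in> borel_measurable (Pi\<^sub>M {..k} G)"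
      by (intro measurable_exp_centre) (auto intro!: borel_measurable_times component)
    note [measurable] = component[of k k, OF order_refl]
    have "T k \<in> sets (Pi\<^sub>M {..k} G)"
      unfolding T_def by measurable
    then show ?thesis
      by (simp add: S_def)
  qed
  have section_le: "emeasure (G k) {x \<in> space (G k). f(k := x) \<in> S k} \<le> q k"
    if f: "f \<in> space (Pi\<^sub>M {..<k} G)" for k f
  proof (cases "k \<in> {1..m}")
    case True
    define s where "s = sqrt (real (N choose k))"
    define c where "c = exp_centre (SU2_fps f N) (k - 1)"
    have "s > 0"
      using True \<open>m \<le> N\<close> by (simp add: s_def)
    \<comment> \<open>Since \<open>k \<ge> 1\<close>, the centre reads coefficients up to
      \<open>k - 1\<close> only. The admissible \<open>x\<close> therefore fill a fixed disk with
      centre \<open>c / s\<close> and radius \<open>\<rho> k / s\<close>.\<close>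
    have c: "exp_centre (SU2_fps (f(k := x)) N) (k - 1) = c" for x
      unfolding c_def using True by (intro exp_centre_cong) auto
    have "x \<in> cball (c / s) (\<rho> k / s)" if "f(k := x) \<in> S k" for x
    proof -
      have "cmod (x * s - c) \<le> \<rho> k"
        using that True c[of x] by (simp add: S_def T_def s_def)
      moreover have "x * s - c = - (of_real s * (c / s - x))"
        using \<open>s > 0\<close> by (simp add: algebra_simps)
      ultimately have "s * cmod (c / s - x) \<le> \<rho> k"
        using \<open>s > 0\<close> by (simp only: norm_minus_cancel norm_mult) simp
      then show ?thesis
        using \<open>s > 0\<close> by (simp add: dist_norm field_simps)
    qed
    then have "emeasure (G k) {x \<in> space (G k). f(k := x) \<in> S k}
        \<le> emeasure complex_std_gaussian (cball (c / s) (\<rho> k / s))"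
      unfolding G_def by (intro emeasure_mono) auto
    also have "\<dots> \<le> ennreal ((\<rho> k / s)\<^sup>2)"
      using \<rho>[of k] \<open>s > 0\<close> by (intro emeasure_gaussian_cball_le) simp
    finally show ?thesis
      using True by (simp add: q_def s_def power_divide)
  next
    case False
    then have "q k = 1"
      by (simp only: q_def if_False)
    then show ?thesis
      by (simp add: G_def gaussian.emeasure_le_1)
  qed
  have coeff_eq: "coeff_measure N = Pi\<^sub>M {..<Suc N} G"
    by (simp only: coeff_measure_def G_def lessThan_Suc_atMost)
  have "?E \<subseteq> {f \<in> space (Pi\<^sub>M {..<Suc N} G). \<forall>k<Suc N. restrict f {..k} \<in> S k}"
  proof safe
    fix \<alpha> k assume \<alpha>: "\<alpha> \<in> space (coeff_measure N)" and "k < Suc N"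
      and le: "\<forall>k\<in>{1..m}. cmod (\<alpha> k * complex_of_real (sqrt (real (N choose k)))
        - exp_centre (SU2_fps \<alpha> N) (k - 1)) \<le> \<rho> k"
    have "exp_centre (SU2_fps (restrict \<alpha> {..k}) N) (k - 1) = exp_centre (SU2_fps \<alpha> N) (k - 1)"
      by (intro exp_centre_cong) auto
    then show "restrict \<alpha> {..k} \<in> S k"
      using le by (auto simp: S_def T_def G_def space_PiM)
  qed (simp only: coeff_eq)
  then have "emeasure (coeff_measure N) ?E
      \<le> emeasure (Pi\<^sub>M {..<Suc N} G) {f \<in> space (Pi\<^sub>M {..<Suc N} G). \<forall>k<Suc N. restrict f {..k} \<in> S k}"
    unfolding coeff_eq using S by (intro emeasure_mono sets_PiM_sequential)
  also have "\<dots> \<le> (\<Prod>k<Suc N. q k)"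
    by (intro emeasure_PiM_sequential_le S section_le) (simp add: G_def gaussian.prob_space_axioms)
  also have "\<dots> = (\<Prod>k=1..m. q k)"
    using \<open>m \<le> N\<close> by (intro prod.mono_neutral_right) (auto simp: q_def)
  also have "\<dots> = ennreal (\<Prod>k=1..m. (\<rho> k)\<^sup>2 / real (N choose k))"
    by (simp add: q_def prod_ennreal)
  finally show ?thesis
    using prob_space_coeff_measure[of N]
    by (simp add: finite_measure.emeasure_eq_measure prob_space_def prod_nonneg)
qed

subsection \<open>Probability bounds\<close>

lemma mult_ln_div_le:
  assumes "0 < x" "x \<le> B" "1 \<le> K"
  shows "x * ln (K / x) \<le> B * ln K + (1 :: real)"
proof -
  \<comment> \<open>This is \<open>ln y \<le> y - 1\<close> at \<open>y = 1 / x\<close>; it controls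
    the singular part \<open>- x * ln x\<close> near 0.\<close>
  have "- ln x \<le> 1 / x"
    using ln_le_minus_one[of "1 / x"] assms by (simp add: ln_div)
  then have "x * (- ln x) \<le> 1"
    using mult_left_mono[of "- ln x" "1 / x" x] assms by simp
  moreover have "x * ln K \<le> B * ln K"
    using assms by (intro mult_right_mono) auto
  moreover have "x * ln (K / x) = x * ln K + x * (- ln x)"
    using assms by (simp add: ln_div algebra_simps)
  ultimately show ?thesis
    by linarith
qed

text \<open>Either some coefficient exceeds \<open>N\<close> in modulus, which the union bound over
  \<open>N + 1\<close> Gaussian tails covers, or all confinement conditions hold with a common
  radius factor. The cut-off \<open>m\<close> is left free for later optimisation.\<close>

lemma prob_Hole_le:
  fixes r b :: real
  assumes "r > 0" "N \<ge> 1" "m \<le> N" and b: "b = 3 + ln (1 + r)"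
  shows "measure (coeff_measure N) (Hole N r) \<le> 2 * real (N + 1) * exp (- (real N)\<^sup>2 / 2)
    + (\<Prod>k=1..m. (2 * (b * (real N)\<^sup>2) * (2 / r) ^ k)\<^sup>2 / real (N choose k))"
proof -
  interpret P: prob_space "coeff_measure N"
    by (rule prob_space_coeff_measure)
  define \<rho> where "\<rho> k = 2 * (b * (real N)\<^sup>2) * (2 / r) ^ k" for k :: nat
  define E where "E = {\<alpha> \<in> space (coeff_measure N). \<forall>k\<in>{1..m}.
      cmod (\<alpha> k * complex_of_real (sqrt (real (N choose k))) - exp_centre (SU2_fps \<alpha> N) (k - 1)) \<le> \<rho> k}"
  define L where "L j = {\<alpha> \<in> space (coeff_measure N). \<alpha> j \<in> {w. real N < cmod w}}" for j
  \<comment> \<open>Twice the bound of \<open>norm_SU2_poly_le\<close> with \<open>B = N\<close>,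
    which makes it strict.\<close>
  define K where "K = 2 * real N * (1 + r) ^ N"
  have "ln (1 + r) \<ge> 0" "b \<ge> 0"
    using \<open>r > 0\<close> b by (simp_all add: ln_ge_zero)
  then have \<rho>: "\<rho> k \<ge> 0" for k
    using \<open>r > 0\<close> by (simp add: \<rho>_def)
  have pow: "(1 + r) ^ N \<ge> 1"
    using \<open>r > 0\<close> by (intro one_le_power) auto
  have "K \<ge> 1" "real N * (1 + r) ^ N < K"
    using pow \<open>N \<ge> 1\<close> mult_mono[of 1 "2 * real N" 1 "(1 + r) ^ N"] by (auto simp: K_def)
  \<comment> \<open>The 3 in \<open>b\<close> is 2 from \<open>ln (2 * N) \<le> 2 * N\<close> plus 1
    from \<open>1 \<le> N^2\<close>; the growth factor contributes
    \<open>ln (1 + r)\<close>.\<close>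
  have lnK: "real N * ln K + 1 \<le> b * (real N)\<^sup>2"
  proof -
    have "ln K = ln (2 * real N) + real N * ln (1 + r)"
      using \<open>r > 0\<close> \<open>N \<ge> 1\<close> by (simp add: K_def ln_mult ln_realpow)
    also have "\<dots> \<le> (2 + ln (1 + r)) * real N"
      using ln_le_minus_one[of "2 * real N"] \<open>N \<ge> 1\<close> by (simp add: algebra_simps)
    finally have "real N * ln K \<le> real N * ((2 + ln (1 + r)) * real N)"
      by (intro mult_left_mono) auto
    moreover have "1 \<le> (real N)\<^sup>2"
      using \<open>N \<ge> 1\<close> by simp
    ultimately show ?thesis
      by (simp add: b power2_eq_square algebra_simps)
  qed
  have "Hole N r \<subseteq> (\<Union>j\<le>N. L j) \<union> E"
  proof
    fix \<alpha> assume \<alpha>: "\<alpha> \<in> Hole N r"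
    then have space: "\<alpha> \<in> space (coeff_measure N)"
      by (simp add: Hole_def)
    show "\<alpha> \<in> (\<Union>j\<le>N. L j) \<union> E"
    proof (cases "\<forall>j\<le>N. cmod (\<alpha> j) \<le> real N")
      case True
      have "cmod (\<alpha> 0) * ln (K / cmod (\<alpha> 0)) \<le> real N * ln K + 1"
        using True Hole_nonzero[OF \<alpha> \<open>r > 0\<close>] \<open>K \<ge> 1\<close> by (intro mult_ln_div_le) auto
      then have *: "cmod (\<alpha> 0) * ln (K / cmod (\<alpha> 0)) \<le> b * (real N)\<^sup>2"
        using lnK by linarith
      have "cmod (\<alpha> k * complex_of_real (sqrt (real (N choose k))) - exp_centre (SU2_fps \<alpha> N) (k - 1)) \<le> \<rho> k"
        if k: "k \<in> {1..m}" for k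
      proof -
        have "k = Suc (k - 1)"
          using k by simp
        then have "cmod (\<alpha> k * complex_of_real (sqrt (real (N choose k))) - exp_centre (SU2_fps \<alpha> N) (k - 1))
            \<le> 2 * (cmod (\<alpha> 0) * ln (K / cmod (\<alpha> 0))) * (2 / r) ^ k"
          using Hole_coeff_bound[OF \<open>r > 0\<close> \<alpha> _ \<open>real N * (1 + r) ^ N < K\<close>, of "k - 1"] True by auto
        also have "\<dots> \<le> \<rho> k"
          unfolding \<rho>_def using * \<open>r > 0\<close> by (intro mult_right_mono mult_left_mono) auto
        finally show ?thesis .
      qed
      then show ?thesis
        using space by (simp add: E_def)
    next
      case False
      then show ?thesis
        using space by (auto simp: L_def not_le)
    qed
  qed
  moreover have L: "L j \<in> sets (coeff_measure N)" if "j \<le> N" for j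
  proof -
    note [measurable] = measurable_coeff_component[OF that]
    show ?thesis
      unfolding L_def by measurable
  qed
  moreover have E: "E \<in> sets (coeff_measure N)"
  proof -
    have "{\<alpha> \<in> space (coeff_measure N). cmod (\<alpha> k * complex_of_real (sqrt (real (N choose k)))
        - exp_centre (SU2_fps \<alpha> N) (k - 1)) \<le> \<rho> k} \<in> sets (coeff_measure N)" if "k \<in> {1..m}" for k
    proof -
      have "k \<le> N"
        using that \<open>m \<le> N\<close> by simp
      note [measurable] = measurable_coeff_component[OF this]
      have [measurable]: "(\<lambda>\<alpha>. exp_centre (SU2_fps \<alpha> N) (k - 1)) \<in> borel_measurable (coeff_measure N)"
        using \<open>k \<le> N\<close> by (intro measurable_exp_centre) (auto intro!: borel_measurable_times measurable_coeff_component)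
      show ?thesis
        by measurable
    qed
    then show ?thesis
      unfolding E_def by (intro sets.sets_Collect_finite_All) auto
  qed
  ultimately have "P.prob (Hole N r) \<le> P.prob ((\<Union>j\<le>N. L j) \<union> E)"
    by (intro P.finite_measure_mono) auto
  also have "\<dots> \<le> P.prob (\<Union>j\<le>N. L j) + P.prob E"
    using L E by (intro measure_Un_le) auto
  also have "P.prob (\<Union>j\<le>N. L j) \<le> (\<Sum>j\<le>N. P.prob (L j))"
    using L by (intro P.finite_measure_subadditive_finite) auto
  also have "(\<Sum>j\<le>N. P.prob (L j)) \<le> (\<Sum>j\<le>N. 2 * exp (- (real N)\<^sup>2 / 2))"
  proof (intro sum_mono)
    fix j assume "j \<in> {..N}"
    then show "P.prob (L j) \<le> 2 * exp (- (real N)\<^sup>2 / 2)"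
      unfolding L_def using prob_gaussian_tail_le[of "real N"]
      by (subst measure_coeff_measure_component) auto
  qed
  also have "(\<Sum>j\<le>N. 2 * exp (- (real N)\<^sup>2 / 2)) = 2 * real (N + 1) * exp (- (real N)\<^sup>2 / 2)"
    by simp
  also have "P.prob E \<le> (\<Prod>k=1..m. (\<rho> k)\<^sup>2 / real (N choose k))"
    unfolding E_def using \<open>m \<le> N\<close> \<rho> by (rule prob_exp_centre_le)
  finally show ?thesis
    unfolding \<rho>_def by linarith
qed

text \<open>With \<open>(N / k)^k \<le> N choose k\<close> the \<open>k\<close>-th factor is at most
  \<open>a^2 * (4 * k / (r^2 * N))^k\<close>. The choice of \<open>\<kappa>\<close> makes the base
  at most \<open>exp (- 2)\<close> for all \<open>k \<le> m\<close>, and the exponents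
  \<open>2 * k\<close> add up to \<open>m * (m + 1)\<close>.\<close>

lemma confinement_prod_le:
  fixes r a \<kappa> :: real
  assumes "r > 0" "N \<ge> 1" "m \<le> N" "real m \<le> \<kappa> * real N" and \<kappa>: "4 * \<kappa> \<le> r\<^sup>2 * exp (- 2)"
  shows "(\<Prod>k=1..m. (a * (2 / r) ^ k)\<^sup>2 / real (N choose k)) \<le> a ^ (2 * m) * exp (- (real m * (real m + 1)))"
proof -
  have factor: "(a * (2 / r) ^ k)\<^sup>2 / real (N choose k) \<le> a\<^sup>2 * exp (- 2 * real k)"
    if k: "k \<in> {1..m}" for k
  proof -
    have "(real N / real k) ^ k \<le> real (N choose k)"
      using k \<open>m \<le> N\<close> binomial_ge_n_over_k_pow_k[of k N, where 'a = real] by simp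
    moreover have "0 < (real N / real k) ^ k"
      using k \<open>N \<ge> 1\<close> by (intro zero_less_power) simp
    ultimately have "(a * (2 / r) ^ k)\<^sup>2 / real (N choose k) \<le> (a * (2 / r) ^ k)\<^sup>2 / (real N / real k) ^ k"
      using k \<open>m \<le> N\<close> by (intro divide_left_mono mult_pos_pos) auto
    also have "\<dots> = a\<^sup>2 * (4 * real k / (r\<^sup>2 * real N)) ^ k"
    proof -
      have "((2 / r) ^ k)\<^sup>2 = (4 / r\<^sup>2) ^ k"
        by (simp only: power_mult[symmetric] mult.commute[of k 2]) (simp add: power_mult power_divide)
      moreover have "(4 / r\<^sup>2) ^ k / (real N / real k) ^ k = (4 * real k / (r\<^sup>2 * real N)) ^ k"
        by (simp only: power_divide[symmetric]) simp
      ultimately show ?thesis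
        by (simp only: power_mult_distrib times_divide_eq_right[symmetric])
    qed
    also have "\<dots> \<le> a\<^sup>2 * exp (- 2) ^ k"
    proof (intro mult_left_mono power_mono)
      have "4 * real k \<le> 4 * \<kappa> * real N"
        using k \<open>real m \<le> \<kappa> * real N\<close> by simp
      also have "\<dots> \<le> r\<^sup>2 * exp (- 2) * real N"
        using \<kappa> by (intro mult_right_mono) auto
      finally show "4 * real k / (r\<^sup>2 * real N) \<le> exp (- 2)"
        using \<open>r > 0\<close> \<open>N \<ge> 1\<close> by (simp add: field_simps)
    qed auto
    finally show ?thesis
      by (simp add: exp_of_nat_mult[symmetric] mult.commute)
  qed
  have "(\<Prod>k=1..m. (a * (2 / r) ^ k)\<^sup>2 / real (N choose k)) \<le> (\<Prod>k=1..m. a\<^sup>2 * exp (- 2 * real k))"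
    using factor by (intro prod_mono) auto
  also have "\<dots> = a ^ (2 * m) * exp (\<Sum>k=1..m. - 2 * real k)"
    by (simp add: prod.distrib exp_sum power_mult)
  also have "(\<Sum>k=1..m. - 2 * real k) = - (real m * (real m + 1))"
    by (induction m) (simp_all add: algebra_simps)
  finally show ?thesis .
qed

text \<open>With \<open>m\<close> the integer part of \<open>\<kappa> * N\<close>, the loss
  \<open>a ^ (2 * m)\<close> is only \<open>exp (O (N * ln N))\<close> and is beaten by a gain of
  order \<open>exp (- \<kappa>^2 * N^2)\<close>.\<close>

lemma eventually_prob_Hole_le:
  assumes "r > 0"
  obtains c where "c > 0"
    "eventually (\<lambda>N. measure (coeff_measure N) (Hole N r) \<le> exp (- c * (real N)\<^sup>2)) sequentially"
proof -
  define b where "b = 3 + ln (1 + r)"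
  \<comment> \<open>The first argument ensures \<open>m \<le> N\<close>, the second is the threshold
    of \<open>confinement_prod_le\<close>.\<close>
  define \<kappa> where "\<kappa> = min 1 (r\<^sup>2 * exp (- 2) / 4)"
  have "b \<ge> 3"
    using \<open>r > 0\<close> by (simp add: b_def ln_ge_zero)
  have \<kappa>: "0 < \<kappa>" "\<kappa> \<le> 1" "4 * \<kappa> \<le> r\<^sup>2 * exp (- 2)"
    using \<open>r > 0\<close> by (auto simp: \<kappa>_def min_def)
  have bound: "measure (coeff_measure N) (Hole N r) \<le> 2 * (real N + 1) * exp (- (real N)\<^sup>2 / 2)
      + exp (\<kappa> * real N * (2 * ln (2 * (b * (real N)\<^sup>2))) - \<kappa> * real N * (\<kappa> * real N - 1))"
    if "N \<ge> 1" "\<kappa> * real N \<ge> 1" for N :: nat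
  proof -
    define m where "m = nat \<lfloor>\<kappa> * real N\<rfloor>"
    define a where "a = 2 * (b * (real N)\<^sup>2)"
    have m: "real m \<le> \<kappa> * real N" "\<kappa> * real N \<le> real m + 1"
      using that by (simp_all add: m_def)
    have "real m \<le> real N"
      using m(1) mult_right_mono[OF \<kappa>(2), of "real N"] by simp
    then have "m \<le> N" by simp
    have "1 * 1 \<le> b * (real N)\<^sup>2"
      using \<open>b \<ge> 3\<close> \<open>N \<ge> 1\<close> by (intro mult_mono) auto
    then have "a \<ge> 1"
      by (simp add: a_def)
    have "a ^ (2 * m) = exp (real m * (2 * ln a))"
      using \<open>a \<ge> 1\<close> by (simp add: exp_of_nat_mult power_mult exp_double)
    also have "\<dots> * exp (- (real m * (real m + 1))) = exp (real m * (2 * ln a) - real m * (real m + 1))"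
      by (simp add: exp_diff exp_minus divide_inverse)
    also have "\<dots> \<le> exp (\<kappa> * real N * (2 * ln a) - \<kappa> * real N * (\<kappa> * real N - 1))"
    proof -
      have "real m * (2 * ln a) \<le> \<kappa> * real N * (2 * ln a)"
        using m \<open>a \<ge> 1\<close> by (intro mult_right_mono) auto
      moreover have "(\<kappa> * real N - 1) * (\<kappa> * real N) \<le> real m * (real m + 1)"
        using m that by (intro mult_mono) auto
      ultimately show ?thesis
        by (simp add: mult.commute)
    qed
    finally show ?thesis
      using prob_Hole_le[OF \<open>r > 0\<close> \<open>N \<ge> 1\<close> \<open>m \<le> N\<close> b_def]
        confinement_prod_le[OF \<open>r > 0\<close> \<open>N \<ge> 1\<close> \<open>m \<le> N\<close> m(1) \<kappa>(3), of a]
      by (simp add: a_def algebra_simps)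
  qed
  \<comment> \<open>Three quarters of \<open>\<kappa>^2\<close> absorb the logarithm and one quarter
    is kept. Since \<open>c \<le> 1 / 4\<close>, the tail term also obeys this rate; each of the two
    terms is to be at most half of the target.\<close>
  define c where "c = \<kappa>\<^sup>2 / 4"
  have "c > 0" "c \<le> 1 / 4"
    using \<kappa> by (auto simp: c_def power_le_one)
  have "eventually (\<lambda>N. 2 * (real N + 1) * exp (- (real N)\<^sup>2 / 2) \<le> exp (- (1 / 4) * (real N)\<^sup>2) / 2) sequentially"
    by real_asymp
  moreover have "eventually (\<lambda>N. 2 * ln (2 * (b * (real N)\<^sup>2)) + 2 \<le> 3 / 4 * \<kappa> * real N) sequentially"
    using \<kappa>(1) \<open>b \<ge> 3\<close> by real_asymp
  moreover have "eventually (\<lambda>N. \<kappa> * real N \<ge> 1) sequentially"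
    using \<kappa>(1) by real_asymp
  ultimately have "eventually (\<lambda>N. measure (coeff_measure N) (Hole N r) \<le> exp (- c * (real N)\<^sup>2)) sequentially"
    using eventually_ge_at_top[of 1]
  proof eventually_elim
    case (elim N)
    have "exp (- (1 / 4) * (real N)\<^sup>2) \<le> exp (- c * (real N)\<^sup>2)"
      using mult_right_mono[OF \<open>c \<le> 1 / 4\<close>, of "(real N)\<^sup>2"] by simp
    moreover have "exp (\<kappa> * real N * (2 * ln (2 * (b * (real N)\<^sup>2))) - \<kappa> * real N * (\<kappa> * real N - 1))
        \<le> exp (- c * (real N)\<^sup>2) / 2"
    proof -
      \<comment> \<open>One unit of the added 2 pays for rounding \<open>\<kappa> * N\<close> down;
        the other leaves \<open>- \<kappa> * N \<le> - ln 2\<close>, which is the factor one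
        half.\<close>
      have "\<kappa> * real N * (2 * ln (2 * (b * (real N)\<^sup>2)) + 2) \<le> \<kappa> * real N * (3 / 4 * \<kappa> * real N)"
        using elim \<kappa>(1) by (intro mult_left_mono) auto
      moreover have "ln 2 \<le> \<kappa> * real N"
        using elim ln_le_minus_one[of 2] by linarith
      ultimately have "\<kappa> * real N * (2 * ln (2 * (b * (real N)\<^sup>2))) - \<kappa> * real N * (\<kappa> * real N - 1)
          \<le> - c * (real N)\<^sup>2 - ln 2"
        by (simp add: c_def power2_eq_square algebra_simps)
      then have "exp (\<kappa> * real N * (2 * ln (2 * (b * (real N)\<^sup>2))) - \<kappa> * real N * (\<kappa> * real N - 1))
          \<le> exp (- c * (real N)\<^sup>2 - ln 2)"
        by (simp only: exp_le_cancel_iff)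
      also have "\<dots> = exp (- c * (real N)\<^sup>2) / 2"
        by (simp add: exp_diff)
      finally show ?thesis .
    qed
    ultimately show ?case
      using elim bound[of N] by linarith
      qed
  with \<open>c > 0\<close> show ?thesis
    by (rule that)
qed

text \<open>A box of positive probability misses the hole event: if \<open>\<alpha> 0\<close> is
  tiny while \<open>\<alpha> 1\<close> is not, the confinement of the linear coefficient fails. The
  strict bound will absorb the finitely many small degrees.\<close>

lemma prob_Hole_less_1:
  assumes "r > 0" "N \<ge> 1"
  shows "measure (coeff_measure N) (Hole N r) < 1"
proof -
  interpret P: prob_space "coeff_measure N"
    by (rule prob_space_coeff_measure)
  define K where "K = 3 * (1 + r) ^ N"
  have K: "2 * (1 + r) ^ N < K" "K > 0"
    using \<open>r > 0\<close> by (simp_all add: K_def)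
  have "eventually (\<lambda>x. 2 * (x * ln (K / x)) * (2 / r) < 1 / 2) (at_right 0)"
    using K \<open>r > 0\<close> by real_asymp
  then obtain \<epsilon>' where "\<epsilon>' > 0" and \<epsilon>':
      "\<And>x. 0 < x \<Longrightarrow> x < \<epsilon>' \<Longrightarrow> 2 * (x * ln (K / x)) * (2 / r) < 1 / 2"
    unfolding eventually_at_right_field by auto
  \<comment> \<open>The minimum with 1 keeps \<open>\<alpha> 0\<close> below the common bound 2;
    halving keeps the closed disk strictly inside the range of \<open>\<epsilon>'\<close>.\<close>
  define \<epsilon> where "\<epsilon> = min 1 (\<epsilon>' / 2)"
  have \<epsilon>: "0 < \<epsilon>" "\<epsilon> \<le> 1" "\<epsilon> < \<epsilon>'"
    using \<open>\<epsilon>' > 0\<close> by (auto simp: \<epsilon>_def)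
  define A :: "nat \<Rightarrow> complex set" where
    "A j = (if j = 0 then cball 0 \<epsilon> else if j = 1 then cball 0 2 - cball 0 (1 / 2) else cball 0 2)" for j
  have A: "A j \<in> sets borel" for j
    by (simp add: A_def)
  have "0 < gaussian.prob (A j)" for j
  proof -
    have ball: "0 < gaussian.prob (cball 0 R)" if "R > 0" for R
      using prob_gaussian_cball_ge[of R] that by (intro less_le_trans[OF _ prob_gaussian_cball_ge]) auto
    have "gaussian.prob (cball 0 (1 / 2)) \<le> 1 / 4"
      using prob_gaussian_cball_le[of "1 / 2" 0] by (simp add: power2_eq_square)
    \<comment> \<open>The annulus has positive mass: the outer disk has at least
      \<open>1 - 2 / 3\<close>, the inner one at most \<open>1 / 4\<close>.\<close>
    moreover have "1 / 4 < gaussian.prob (cball 0 2)"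
    proof -
      have "exp (- 2) \<le> (1 / 3 :: real)"
        using exp_ge_add_one_self[of 2] by (simp add: exp_minus divide_simps)
      moreover have "gaussian.prob {w. 2 < cmod w} \<le> 2 * exp (- 2)"
        using prob_gaussian_tail_le[of 2] by simp
      moreover have "gaussian.prob (cball 0 2) = 1 - gaussian.prob {w. 2 < cmod w}"
        by (subst gaussian.prob_compl[symmetric]) (auto intro!: arg_cong[where f = gaussian.prob] simp: not_less)
      ultimately show ?thesis by linarith
    qed
    ultimately have "0 < gaussian.prob (cball 0 2 - cball 0 (1 / 2))"
      by (subst gaussian.finite_measure_Diff) (auto simp: subset_iff)
    with ball[of \<epsilon>] ball[of 2] \<epsilon> show ?thesis
      by (simp add: A_def)
  qed
  then have "0 < P.prob (Pi\<^sub>E {..N} A)"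
    by (subst measure_coeff_measure_box[OF A]) (simp add: prod_pos)
  have "Hole N r \<inter> Pi\<^sub>E {..N} A = {}"
  proof safe
    fix \<alpha> assume \<alpha>: "\<alpha> \<in> Hole N r" and box: "\<alpha> \<in> Pi\<^sub>E {..N} A"
    have A_mem: "\<alpha> j \<in> A j" if "j \<le> N" for j
      using box that by auto
    have "cmod (\<alpha> j) \<le> 2" if "j \<le> N" for j
      using A_mem[OF that] \<epsilon> by (auto simp: A_def split: if_splits)
    \<comment> \<open>At index 0 the sum in \<open>exp_centre\<close> is empty, so the confining
      disk is centred at 0.\<close>
    from Hole_coeff_bound[OF \<open>r > 0\<close> \<alpha> this K(1), of 0]
    have "cmod (\<alpha> 1) * sqrt (real N) \<le> 2 * (cmod (\<alpha> 0) * ln (K / cmod (\<alpha> 0))) * (2 / r)"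
      by (simp add: exp_centre_def norm_mult)
    also have "\<dots> < 1 / 2"
      using A_mem[of 0] Hole_nonzero[OF \<alpha> \<open>r > 0\<close>] \<epsilon> by (intro \<epsilon>') (auto simp: A_def)
    finally have "cmod (\<alpha> 1) * sqrt (real N) < 1 / 2" .
    moreover have "cmod (\<alpha> 1) * 1 \<le> cmod (\<alpha> 1) * sqrt (real N)"
      using \<open>N \<ge> 1\<close> by (intro mult_left_mono) auto
    moreover have "1 / 2 < cmod (\<alpha> 1)"
      using A_mem[of 1] \<open>N \<ge> 1\<close> by (simp add: A_def not_le)
    ultimately show "\<alpha> \<in> {}"
      by linarith
  qed
  moreover have "Pi\<^sub>E {..N} A \<in> sets (coeff_measure N)"
    unfolding sets_coeff_measure using A by (intro sets_PiM_I_finite) auto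
  ultimately have "P.prob (Hole N r) + P.prob (Pi\<^sub>E {..N} A) \<le> 1"
    using P.finite_measure_Union[OF sets_Hole, of "Pi\<^sub>E {..N} A" r] P.prob_le_1 by metis
  with \<open>0 < P.prob (Pi\<^sub>E {..N} A)\<close> show ?thesis
    by linarith
qed

section \<open>Lower bound for the hole probability\<close>

lemma prob_Hole_ge:
  assumes "r > 0" "N \<ge> 1"
  shows "exp (- (2 + 2 * ln 2 + 2 * ln (1 + r)) * (real N)\<^sup>2) \<le> measure (coeff_measure N) (Hole N r)"
proof -
  interpret P: prob_space "coeff_measure N"
    by (rule prob_space_coeff_measure)
  \<comment> \<open>This is \<open>(1 + r)^(-N) / 2\<close>, chosen so that the non-constant terms
    total at most \<open>1 / 2\<close>. Each of the \<open>N\<close> small coefficients costs about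
    \<open>\<delta>^2\<close>, whence the exponent of order \<open>N^2\<close>.\<close>
  define \<delta> where "\<delta> = exp (- ln 2 - real N * ln (1 + r))"
  have pow: "(1 + r) ^ N = exp (real N * ln (1 + r))"
    using \<open>r > 0\<close> by (simp add: exp_of_nat_mult)
  have \<delta>: "\<delta> * (1 + r) ^ N = 1 / 2" "\<delta> > 0"
    by (simp_all add: \<delta>_def pow exp_diff exp_minus)
  have "0 \<le> real N * ln (1 + r)"
    using \<open>r > 0\<close> by simp
  moreover have "0 \<le> ln (2 :: real)"
    by simp
  ultimately have "- ln 2 - real N * ln (1 + r) \<le> 0"
    by linarith
  then have "\<delta> \<le> 1"
    unfolding \<delta>_def by (simp only: exp_le_one_iff)
  define A :: "nat \<Rightarrow> complex set" where "A j = (if j = 0 then - cball 0 (1 / 2) else cball 0 \<delta>)" for j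
  have A: "A j \<in> sets borel" for j
    by (simp add: A_def)
  have sub: "Pi\<^sub>E {..N} A \<subseteq> Hole N r"
  proof
    fix \<alpha> assume \<alpha>: "\<alpha> \<in> Pi\<^sub>E {..N} A"
    have "SU2_poly \<alpha> N z \<noteq> 0" if "cmod z < r" for z
    proof
      assume "SU2_poly \<alpha> N z = 0"
      \<comment> \<open>Deleting the constant term makes \<open>norm_SU2_poly_le\<close> applicable
        to the remainder with \<open>B = \<delta>\<close>.\<close>
      define \<beta> where "\<beta> = \<alpha>(0 := 0)"
      have "SU2_poly \<alpha> N z = \<alpha> 0 + SU2_poly \<beta> N z"
        by (simp add: SU2_poly_def \<beta>_def sum.atMost_shift)
      then have "cmod (\<alpha> 0) = cmod (SU2_poly \<beta> N z)"
        using \<open>SU2_poly \<alpha> N z = 0\<close> by (simp add: add_eq_0_iff2)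
      also have "\<dots> \<le> \<delta> * (1 + r) ^ N"
      proof (rule norm_SU2_poly_le)
        fix j assume "j \<le> N"
        then have "\<alpha> j \<in> A j"
          using \<alpha> by auto
        then show "cmod (\<beta> j) \<le> \<delta>"
          using \<open>\<delta> > 0\<close> by (auto simp: \<beta>_def A_def)
      qed (use that in simp)
      finally have "cmod (\<alpha> 0) \<le> 1 / 2"
        by (simp add: \<delta>)
      moreover have "\<alpha> 0 \<in> A 0"
        using \<alpha> by auto
      ultimately show False
        by (simp add: A_def)
    qed
    then show "\<alpha> \<in> Hole N r"
      using \<alpha> by (auto simp: Hole_def PiE_iff)
  qed
  \<comment> \<open>The mass is at least \<open>3 / 4\<close>; the weaker \<open>exp (- 1)\<close>
    keeps the whole estimate a single exponential.\<close>
  have "exp (- 1) \<le> gaussian.prob (A 0)"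
  proof -
    have "gaussian.prob (- cball 0 (1 / 2)) = 1 - gaussian.prob (cball 0 (1 / 2))"
      using gaussian.prob_compl[of "cball 0 (1 / 2)"] by (simp add: Compl_eq_Diff_UNIV)
    moreover have "exp (- 1) \<le> (1 / 2 :: real)"
      using exp_ge_add_one_self[of 1] by (simp add: exp_minus divide_simps)
    ultimately show ?thesis
      using prob_gaussian_cball_le[of "1 / 2" 0] by (simp add: A_def power2_eq_square)
  qed
  moreover have small: "exp (- 1) * \<delta>\<^sup>2 \<le> gaussian.prob (cball 0 \<delta>)"
  proof -
    have "exp (- 1) * \<delta>\<^sup>2 \<le> exp (- \<delta>\<^sup>2) * \<delta>\<^sup>2"
      using \<open>\<delta> > 0\<close> \<open>\<delta> \<le> 1\<close> by (intro mult_right_mono) (auto simp: power_le_one)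
    also have "\<dots> \<le> gaussian.prob (cball 0 \<delta>)"
      using \<open>\<delta> > 0\<close> by (intro prob_gaussian_cball_ge) simp
    finally show ?thesis .
  qed
  ultimately have "exp (- 1) * (exp (- 1) * \<delta>\<^sup>2) ^ N \<le> gaussian.prob (A 0) * gaussian.prob (cball 0 \<delta>) ^ N"
    by (intro mult_mono power_mono) auto
  also have "\<dots> = (\<Prod>j\<le>N. gaussian.prob (A j))"
    by (simp add: prod.atMost_shift A_def)
  also have "\<dots> = P.prob (Pi\<^sub>E {..N} A)"
    using A by (simp add: measure_coeff_measure_box)
  also have "\<dots> \<le> P.prob (Hole N r)"
    using sub sets_Hole by (intro P.finite_measure_mono) auto
  finally have "exp (- 1) * (exp (- 1) * \<delta>\<^sup>2) ^ N \<le> P.prob (Hole N r)" .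
  moreover have "exp (- 1) * (exp (- 1) * \<delta>\<^sup>2) ^ N
      = exp (- 1 - real N * (1 + 2 * ln 2 + 2 * (real N * ln (1 + r))))"
    by (simp only: \<delta>_def exp_double[symmetric] mult_exp_exp exp_of_nat_mult[symmetric])
       (simp add: algebra_simps)
  \<comment> \<open>The leading 2 collects \<open>exp (- 1)\<close> from the constant term and one
    \<open>exp (- 1)\<close> per small disk, using \<open>1 \<le> N^2\<close> and
    \<open>N \<le> N^2\<close>.\<close>
  moreover have "exp (- (2 + 2 * ln 2 + 2 * ln (1 + r)) * (real N)\<^sup>2)
      \<le> exp (- 1 - real N * (1 + 2 * ln 2 + 2 * (real N * ln (1 + r))))"
  proof -
    have "1 \<le> (real N)\<^sup>2"
      using \<open>N \<ge> 1\<close> by simp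
    moreover have "real N \<le> (real N)\<^sup>2"
      using \<open>N \<ge> 1\<close> by (intro self_le_power) auto
    then have "(1 + 2 * ln 2) * real N \<le> (1 + 2 * ln 2) * (real N)\<^sup>2"
      by (intro mult_left_mono add_nonneg_nonneg) auto
    ultimately have "- (2 + 2 * ln 2 + 2 * ln (1 + r)) * (real N)\<^sup>2
        \<le> - 1 - real N * (1 + 2 * ln 2 + 2 * (real N * ln (1 + r)))"
      by (simp add: power2_eq_square algebra_simps)
    then show ?thesis
      by (simp only: exp_le_cancel_iff)
  qed
  ultimately show ?thesis
    by linarith
qed

section \<open>Passage from large degrees to all degrees, and the theorem\<close>

lemma gaussian_rate_from_eventually:
  fixes p :: "nat \<Rightarrow> real"
  assumes p: "\<And>N. N \<ge> 1 \<Longrightarrow> 0 < p N \<and> p N < 1"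
    and "c > 0" and ev: "eventually (\<lambda>N. p N \<le> exp (- c * (real N)\<^sup>2)) sequentially"
  obtains c' where "c' > 0" "\<And>N. N \<ge> 1 \<Longrightarrow> p N \<le> exp (- c' * (real N)\<^sup>2)"
proof -
  from ev obtain N0 where N0: "\<And>N. N \<ge> N0 \<Longrightarrow> p N \<le> exp (- c * (real N)\<^sup>2)"
    by (auto simp: eventually_sequentially)
  \<comment> \<open>Each \<open>N \<le> N0\<close> has its own exact rate, positive because
    \<open>0 < p N < 1\<close>; the rate \<open>c\<close> serves all larger \<open>N\<close>. A
    finite set of positive rates has a positive minimum.\<close>
  define R where "R = insert c ((\<lambda>N. - ln (p N) / (real N)\<^sup>2) ` {1..N0})"
  have R: "finite R" "R \<noteq> {}"
    by (auto simp: R_def)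
  show ?thesis
  proof
    have "x > 0" if "x \<in> R" for x
      using that p \<open>c > 0\<close> by (auto simp: R_def intro!: divide_neg_pos ln_less_zero)
    then show "Min R > 0"
      using R by simp
    show "p N \<le> exp (- Min R * (real N)\<^sup>2)" if "N \<ge> 1" for N
    proof (cases "N \<le> N0")
      case True
      have "Min R \<le> - ln (p N) / (real N)\<^sup>2"
        using True that by (intro Min_le) (auto simp: R_def)
      then have "ln (p N) \<le> - Min R * (real N)\<^sup>2"
        using that by (simp add: field_simps)
      then show ?thesis
        using p[OF that] by (simp flip: ln_le_cancel_iff)
    next
      case False
      have "Min R \<le> c"
        by (intro Min_le) (auto simp: R_def)
      then have "exp (- c * (real N)\<^sup>2) \<le> exp (- Min R * (real N)\<^sup>2)"
        by (simp add: mult_right_mono)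
      with N0[of N] False show ?thesis
        by linarith
    qed
  qed
qed

theorem theorem2:
  fixes r :: real
  assumes "r > 0"
  shows "\<exists>c1 c2 :: real. c1 > 0 \<and> c2 > 0 \<and>
    (\<forall>N::nat. N \<ge> 1 \<longrightarrow>
      exp (- c2 * (real N)\<^sup>2) \<le> measure (coeff_measure N) (Hole N r) \<and>
      measure (coeff_measure N) (Hole N r) \<le> exp (- c1 * (real N)\<^sup>2))"
proof -
  define p where "p N = measure (coeff_measure N) (Hole N r)" for N
  define c2 where "c2 = 2 + 2 * ln 2 + 2 * ln (1 + r)"
  have lower: "exp (- c2 * (real N)\<^sup>2) \<le> p N" if "N \<ge> 1" for N
    using prob_Hole_ge[OF assms that] by (simp add: p_def c2_def)
  \<comment> \<open>Positivity is read off from the lower bound, so that \<open>ln (p N)\<close> is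
    meaningful in the patching of small degrees.\<close>
  have between: "0 < p N \<and> p N < 1" if "N \<ge> 1" for N
    using less_le_trans[OF exp_gt_zero lower[OF that]] prob_Hole_less_1[OF assms that] by (simp add: p_def)
  obtain c where c: "c > 0" "eventually (\<lambda>N. p N \<le> exp (- c * (real N)\<^sup>2)) sequentially"
    using eventually_prob_Hole_le[OF assms] unfolding p_def by blast
  obtain c1 where "c1 > 0" "\<And>N. N \<ge> 1 \<Longrightarrow> p N \<le> exp (- c1 * (real N)\<^sup>2)"
    using gaussian_rate_from_eventually[of p, OF between c] by blast
  moreover have "c2 > 0"
    using assms by (simp add: c2_def add_pos_pos)
  ultimately show ?thesis
    using lower unfolding p_def by blast
qed

end
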